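(* Let $d\ge1$ be an integer, let $\nu_1$ be a probability measure on $\{1,\dots,d\}$, and let $\nu_0$ be a (nonnegative) measure on $\{1,\dots,d\}$ with total mass $m_0:=\sum_i\nu_0(i)>1$. Put $\widetilde\nu_0:=\frac1{m_0}\nu_0$. Let $\alpha$ be any measure on $\{1,\dots,d\}^2$. Define $\gamma_\alpha^{(0)}:=\alpha$ and, for every $k\in\mathbb N$, $$\gamma_\alpha^{(2k+1)}:=\mathrm{Proj}^{\mathrm{KL}}_{\mathcal C^1_{\nu_0}}\big(\gamma_\alpha^{(2k)}\big),\qquad \gamma_\alpha^{(2k+2)}:=\mathrm{Proj}^{\mathrm{KL}}_{\mathcal C^2_{\nu_1}}\big(\gamma_\alpha^{(2k+1)}\big).$$ Then the even sequence converges, $$\gamma_\alpha^{(2k)}\xrightarrow{k\to+\infty}\mathrm{Proj}^{\mathrm{KL}}_{\Pi(\widetilde\nu_0,\nu_1)}(\alpha)\in\mathcal C^2_{\nu_1},$$ and the odd sequence converges too, but to another limit, $$\gamma_\alpha^{(2k+1)}\xrightarrow{k\to+\infty}\mathrm{sh}^{-1}\Big(\mathrm{Proj}^{\mathrm{KL}}_{\Pi(\widetilde\nu_0,\nu_1)}(\alpha)\Big)\in\mathcal C^1_{\nu_0}.$$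
   Context: Measures on $\{1,\dots,d\}$ are identified with vectors with nonnegative entries, and measures on $\{1,\dots,d\}^2$ with $d\times d$ matrices with nonnegative entries. For a measure $\mu$ on $\{1,\dots,d\}$ (not necessarily of mass 1), $\mathcal C^1_\mu$ is the set of measures $\gamma$ on $\{1,\dots,d\}^2$ with $\sum_j\gamma_{ij}=\mu(i)$ for all $i$, and $\mathcal C^2_\mu$ is the set of those with $\sum_i\gamma_{ij}=\mu(j)$ for all $j$. Also $\Pi(\widetilde\nu_0,\nu_1)=\mathcal C^1_{\widetilde\nu_0}\cap\mathcal C^2_{\nu_1}$ is the set of transport plans between the probability measures $\widetilde\nu_0$ and $\nu_1$. The Kullback–Leibler divergence is $\mathrm{KL}(\gamma|\alpha)=\sum_{i,j}\gamma_{ij}\log(\gamma_{ij}/\alpha_{ij})$ if $\gamma$ is absolutely continuous with respect to $\alpha$ (terms with $\gamma_{ij}=0$ being $0$), and $\mathrm{KL}(\gamma|\alpha)=+\infty$ otherwise; it is used also when $\gamma,\alpha$ are not probabilities. $\mathrm{Proj}^{\mathrm{KL}}_{\mathcal C}(\alpha)$ denotes the minimizer of $\gamma\mapsto\mathrm{KL}(\gamma|\alpha)$ over $\gamma\in\mathcal C$. The shifting map $\mathrm{sh}\colon\mathcal C^1_{\nu_0}\to\mathcal C^1_{\widetilde\nu_0}$ is the bijection $\mu\mapsto\frac1{m_0}\mu$, so $\mathrm{sh}^{-1}$ is multiplication by $m_0$.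
   Formalization: The measure α is not arbitrary: it is assumed that some transport plan in Π(ν̃₀,ν₁) has finite KL divergence with respect to α; otherwise (e.g. α=0, d≥2) the projections in the statement are not defined. *)

theory Defs
  imports "HOL-Analysis.Analysis"
begin

text \<open>
  The points 1, ..., d are the elements of an arbitrary finite type \<open>'d\<close> (which is nonempty, so
  that d is at least 1). In \<open>\<gamma> $ i $ j\<close>, the row index \<open>i\<close> is the first coordinate.
\<close>

type_synonym 'd mat = "real ^ 'd ^ 'd"

definition is_measure :: "real ^ 'd::finite \<Rightarrow> bool" where
  "is_measure \<mu> \<longleftrightarrow> (\<forall>i. 0 \<le> \<mu> $ i)"

definition is_measure2 :: "'d::finite mat \<Rightarrow> bool" where
  "is_measure2 \<gamma> \<longleftrightarrow> (\<forall>i j. 0 \<le> \<gamma> $ i $ j)"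

definition mass :: "real ^ 'd::finite \<Rightarrow> real" where
  "mass \<mu> = (\<Sum>i\<in>UNIV. \<mu> $ i)"

definition C1 :: "real ^ 'd::finite \<Rightarrow> 'd mat set" where
  "C1 \<mu> = {\<gamma>. is_measure2 \<gamma> \<and> (\<forall>i. (\<Sum>j\<in>UNIV. \<gamma> $ i $ j) = \<mu> $ i)}"

definition C2 :: "real ^ 'd::finite \<Rightarrow> 'd mat set" where
  "C2 \<mu> = {\<gamma>. is_measure2 \<gamma> \<and> (\<forall>j. (\<Sum>i\<in>UNIV. \<gamma> $ i $ j) = \<mu> $ j)}"

definition transport_plans :: "real ^ 'd::finite \<Rightarrow> real ^ 'd \<Rightarrow> 'd mat set" where
  "transport_plans \<mu> \<nu> = C1 \<mu> \<inter> C2 \<nu>"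

definition abs_cont :: "'d::finite mat \<Rightarrow> 'd mat \<Rightarrow> bool" where
  "abs_cont \<gamma> \<alpha> \<longleftrightarrow> (\<forall>i j. \<alpha> $ i $ j = 0 \<longrightarrow> \<gamma> $ i $ j = 0)"

text \<open>The terms with \<open>\<gamma> $ i $ j = 0\<close> vanish because \<open>0 * x = 0\<close> for every real \<open>x\<close>,
  including the junk values of \<open>ln\<close> at 0 and of division by 0.\<close>

definition KL :: "'d::finite mat \<Rightarrow> 'd mat \<Rightarrow> ereal" where
  "KL \<gamma> \<alpha> =
    (if abs_cont \<gamma> \<alpha>
     then ereal (\<Sum>i\<in>UNIV. \<Sum>j\<in>UNIV. \<gamma> $ i $ j * ln (\<gamma> $ i $ j / \<alpha> $ i $ j))
     else \<infinity>)"

text \<open>\<open>KL_proj C \<alpha>\<close> is a total function; it is meaningful only when there is exactly one minimizer,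
  which is what \<open>unique_KL_minimizer C \<alpha>\<close> states.\<close>

definition KL_proj :: "'d::finite mat set \<Rightarrow> 'd mat \<Rightarrow> 'd mat" where
  "KL_proj C \<alpha> = (ARG_MIN (\<lambda>\<gamma>. KL \<gamma> \<alpha>) \<gamma>. \<gamma> \<in> C)"

definition unique_KL_minimizer :: "'d::finite mat set \<Rightarrow> 'd mat \<Rightarrow> bool" where
  "unique_KL_minimizer C \<alpha> \<longleftrightarrow> (\<exists>!\<gamma>. is_arg_min (\<lambda>\<gamma>. KL \<gamma> \<alpha>) (\<lambda>\<gamma>. \<gamma> \<in> C) \<gamma>)"

text \<open>The shifting map is \<open>sh \<nu>\<^sub>0\<close> restricted to \<open>C1 \<nu>\<^sub>0\<close>, and its inverse is \<open>sh_inv \<nu>\<^sub>0\<close>, as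
  confirmed by the two lemmas below.\<close>

definition sh :: "real ^ 'd::finite \<Rightarrow> 'd mat \<Rightarrow> 'd mat" where
  "sh \<nu>\<^sub>0 \<mu> = (1 / mass \<nu>\<^sub>0) *\<^sub>R \<mu>"

definition sh_inv :: "real ^ 'd::finite \<Rightarrow> 'd mat \<Rightarrow> 'd mat" where
  "sh_inv \<nu>\<^sub>0 = inv_into (C1 \<nu>\<^sub>0) (sh \<nu>\<^sub>0)"

lemma C1_scaleR:
  assumes "\<gamma> \<in> C1 \<mu>" and "0 \<le> c"
  shows "c *\<^sub>R \<gamma> \<in> C1 (c *\<^sub>R \<mu>)"
  using assms by (simp add: C1_def is_measure2_def flip: sum_distrib_left)

lemma bij_betw_sh:
  assumes "0 < mass \<nu>\<^sub>0"
  shows "bij_betw (sh \<nu>\<^sub>0) (C1 \<nu>\<^sub>0) (C1 ((1 / mass \<nu>\<^sub>0) *\<^sub>R \<nu>\<^sub>0))"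
proof (rule bij_betw_byWitness[where f' = "\<lambda>\<gamma>. mass \<nu>\<^sub>0 *\<^sub>R \<gamma>"])
  show "(\<lambda>\<gamma>. mass \<nu>\<^sub>0 *\<^sub>R \<gamma>) ` C1 ((1 / mass \<nu>\<^sub>0) *\<^sub>R \<nu>\<^sub>0) \<subseteq> C1 \<nu>\<^sub>0"
    using assms C1_scaleR[of _ "(1 / mass \<nu>\<^sub>0) *\<^sub>R \<nu>\<^sub>0" "mass \<nu>\<^sub>0"] by force
qed (use assms in \<open>auto simp: sh_def intro!: C1_scaleR[of _ _ "1 / mass \<nu>\<^sub>0", simplified]\<close>)

lemma sh_inv_eq:
  assumes "0 < mass \<nu>\<^sub>0" and "\<gamma> \<in> C1 ((1 / mass \<nu>\<^sub>0) *\<^sub>R \<nu>\<^sub>0)"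
  shows "sh_inv \<nu>\<^sub>0 \<gamma> = mass \<nu>\<^sub>0 *\<^sub>R \<gamma>"
  unfolding sh_inv_def
proof (rule inv_into_f_eq)
  show "inj_on (sh \<nu>\<^sub>0) (C1 \<nu>\<^sub>0)"
    using bij_betw_sh[OF assms(1)] by (rule bij_betw_imp_inj_on)
  show "mass \<nu>\<^sub>0 *\<^sub>R \<gamma> \<in> C1 \<nu>\<^sub>0"
    using assms C1_scaleR[OF assms(2), of "mass \<nu>\<^sub>0"] by simp
  show "sh \<nu>\<^sub>0 (mass \<nu>\<^sub>0 *\<^sub>R \<gamma>) = \<gamma>"
    using assms(1) by (simp add: sh_def)
qed

end

(* Since the projection onto C2 does not see a scalar factor, dividing the odd iterates by m0 turns
   the scheme into the usual alternating rescaling for the two marginals nu0/m0 and nu1 of equal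
   mass. There every plan pi << alpha satisfies the Pythagorean identity
   KL(pi|x) = KL(pi|x') + KL(x'|x) at each step x -> x', and the last term does not depend on pi.
   Hence KL(pi|x_k) decreases and consecutive iterates become close, so a cluster point p is a plan;
   applied to p itself, the monotonicity forces the whole sequence to converge to p. Since
   KL(pi|alpha) - KL(pi|x_k) does not depend on pi, p minimizes KL(.|alpha) over the plans. *)

theory Submission
  imports Defs
begin

section \<open>Entropy, Hellinger distance, marginals and rescaling\<close>

definition rel_ent :: "'d::finite mat \<Rightarrow> 'd mat \<Rightarrow> real" where
  "rel_ent \<gamma> \<alpha> = (\<Sum>i\<in>UNIV. \<Sum>j\<in>UNIV. \<gamma> $ i $ j * ln (\<gamma> $ i $ j / \<alpha> $ i $ j))"

text \<open>The squared Hellinger distance without the factor 1/2. Unlike the entropy it stays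
  continuous where entries vanish, so it can be carried to limits.\<close>

definition hellinger :: "'d::finite mat \<Rightarrow> 'd mat \<Rightarrow> real" where
  "hellinger \<gamma> \<alpha> = (\<Sum>i\<in>UNIV. \<Sum>j\<in>UNIV. (sqrt (\<gamma> $ i $ j) - sqrt (\<alpha> $ i $ j))\<^sup>2)"

text \<open>Row and column sums are treated at once: they are the image measures of \<open>\<gamma>\<close> under the two
  coordinate maps \<open>s\<close>.\<close>

definition marginal :: "('d \<Rightarrow> 'd \<Rightarrow> 'd) \<Rightarrow> 'd::finite mat \<Rightarrow> real ^ 'd" where
  "marginal s \<gamma> = (\<chi> k. \<Sum>i\<in>UNIV. \<Sum>j\<in>UNIV. if s i j = k then \<gamma> $ i $ j else 0)"

definition marginal_class :: "('d \<Rightarrow> 'd \<Rightarrow> 'd) \<Rightarrow> real ^ 'd::finite \<Rightarrow> 'd mat set" where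
  "marginal_class s \<mu> = {\<gamma>. is_measure2 \<gamma> \<and> marginal s \<gamma> = \<mu>}"

text \<open>Candidate for the KL projection onto one marginal class. Where the marginal of a measure
  \<open>\<gamma>\<close> vanishes, division by zero yields 0, in agreement with the zero entries of
  \<open>\<gamma>\<close> there.\<close>

definition rescale :: "('d \<Rightarrow> 'd \<Rightarrow> 'd) \<Rightarrow> real ^ 'd::finite \<Rightarrow> 'd mat \<Rightarrow> 'd mat" where
  "rescale s \<mu> \<gamma> = (\<chi> i j. \<gamma> $ i $ j * (\<mu> $ s i j / marginal s \<gamma> $ s i j))"

lemma KL_eq_rel_ent: "KL \<gamma> \<alpha> = (if abs_cont \<gamma> \<alpha> then ereal (rel_ent \<gamma> \<alpha>) else \<infinity>)"
  by (simp add: KL_def rel_ent_def)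

lemma abs_cont_trans: "abs_cont \<gamma> \<beta> \<Longrightarrow> abs_cont \<beta> \<alpha> \<Longrightarrow> abs_cont \<gamma> \<alpha>"
  by (simp add: abs_cont_def)

lemma is_measure2D: "is_measure2 \<gamma> \<Longrightarrow> 0 \<le> \<gamma> $ i $ j"
  by (simp add: is_measure2_def)

lemma is_measure2_scaleR: "is_measure2 \<gamma> \<Longrightarrow> 0 \<le> c \<Longrightarrow> is_measure2 (c *\<^sub>R \<gamma>)"
  by (simp add: is_measure2_def)

section \<open>Marginals as image measures\<close>

lemma C1_eq_marginal_class: "C1 \<mu> = marginal_class (\<lambda>i j. i) \<mu>"
proof -
  have "marginal (\<lambda>i j. i) \<gamma> $ k = (\<Sum>j\<in>UNIV. \<gamma> $ k $ j)" for \<gamma> :: "'a mat" and k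
    by (simp add: marginal_def if_distrib[of "sum _"] sum.delta' cong: if_cong)
       (subst sum.swap, simp)
  then show ?thesis
    by (auto simp: C1_def marginal_class_def vec_eq_iff)
qed

lemma C2_eq_marginal_class: "C2 \<mu> = marginal_class (\<lambda>i j. j) \<mu>"
  by (auto simp: C2_def marginal_class_def vec_eq_iff marginal_def)

text \<open>Change of variables for the image measure: the entries are grouped by the value of
  \<open>s\<close>.\<close>

lemma sum_marginal:
  "(\<Sum>i\<in>UNIV. \<Sum>j\<in>UNIV. \<gamma> $ i $ j * f (s i j)) = (\<Sum>k\<in>UNIV. marginal s \<gamma> $ k * f k)"
proof -
  have "(\<Sum>k\<in>UNIV. marginal s \<gamma> $ k * f k)
      = (\<Sum>k\<in>UNIV. \<Sum>i\<in>UNIV. \<Sum>j\<in>UNIV. if s i j = k then \<gamma> $ i $ j * f k else 0)"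
    by (simp add: marginal_def sum_distrib_right if_distrib[of "\<lambda>x. x * _"] cong: if_cong)
  also have "\<dots> = (\<Sum>i\<in>UNIV. \<Sum>k\<in>UNIV. \<Sum>j\<in>UNIV. if s i j = k then \<gamma> $ i $ j * f k else 0)"
    by (rule sum.swap)
  also have "\<dots> = (\<Sum>i\<in>UNIV. \<Sum>j\<in>UNIV. \<Sum>k\<in>UNIV. if s i j = k then \<gamma> $ i $ j * f k else 0)"
    by (intro sum.cong refl sum.swap)
  finally show ?thesis
    by simp
qed

lemma sum_eq_mass_marginal:
  "(\<Sum>i\<in>UNIV. \<Sum>j\<in>UNIV. \<gamma> $ i $ j) = mass (marginal s \<gamma>)"
  using sum_marginal[of \<gamma> "\<lambda>_. 1" s] by (simp add: mass_def)

lemma sum_marginal_class: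
  "\<gamma> \<in> marginal_class s \<mu> \<Longrightarrow> (\<Sum>i\<in>UNIV. \<Sum>j\<in>UNIV. \<gamma> $ i $ j) = mass \<mu>"
  by (simp add: marginal_class_def sum_eq_mass_marginal[of _ s])

lemma marginal_nonneg: "is_measure2 \<gamma> \<Longrightarrow> 0 \<le> marginal s \<gamma> $ k"
  by (auto simp: marginal_def is_measure2_def intro!: sum_nonneg)

lemma marginal_scaleR: "marginal s (c *\<^sub>R \<gamma>) = c *\<^sub>R marginal s \<gamma>"
  by (simp add: marginal_def vec_eq_iff sum_distrib_left if_distrib[of "\<lambda>x. c * x"] cong: if_cong)

lemma marginal_eq_0_iff:
  assumes "is_measure2 \<gamma>"
  shows "marginal s \<gamma> $ k = 0 \<longleftrightarrow> (\<forall>i j. s i j = k \<longrightarrow> \<gamma> $ i $ j = 0)"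
  using assms by (auto simp: marginal_def is_measure2_def sum_nonneg_eq_0_iff sum_nonneg)

lemma tendsto_marginal:
  assumes "(x \<longlongrightarrow> p) F"
  shows "((\<lambda>n. marginal s (x n) $ k) \<longlongrightarrow> marginal s p $ k) F"
proof -
  have "((\<lambda>n. if s i j = k then x n $ i $ j else 0) \<longlongrightarrow> (if s i j = k then p $ i $ j else 0)) F"
    for i j
    using assms by (auto intro!: tendsto_vec_nth)
  then show ?thesis
    unfolding marginal_def by (simp, intro tendsto_sum)
qed

lemma marginal_class_closed:
  assumes "\<And>n. x n \<in> marginal_class s \<mu>" "x \<longlonglongrightarrow> p"
  shows "p \<in> marginal_class s \<mu>"
proof -
  have "0 \<le> p $ i $ j" for i j
    by (rule LIMSEQ_le_const[OF tendsto_vec_nth[OF tendsto_vec_nth[OF assms(2)]]])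
       (use assms(1) in \<open>auto simp: marginal_class_def is_measure2_def\<close>)
  moreover have "marginal s p $ k = \<mu> $ k" for k
  proof (rule LIMSEQ_unique)
    show "(\<lambda>n. marginal s (x n) $ k) \<longlonglongrightarrow> marginal s p $ k"
      by (rule tendsto_marginal) fact
    show "(\<lambda>n. marginal s (x n) $ k) \<longlonglongrightarrow> \<mu> $ k"
      using assms(1) by (simp add: marginal_class_def)
  qed
  ultimately show ?thesis
    by (simp add: marginal_class_def is_measure2_def vec_eq_iff)
qed

section \<open>Hellinger distance against relative entropy\<close>

lemma sqrt_diff_sq_le:
  fixes a b :: real
  assumes "0 \<le> a" "0 \<le> b" "b = 0 \<Longrightarrow> a = 0"
  shows "(sqrt a - sqrt b)\<^sup>2 \<le> a * ln (a / b) - a + b"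
proof (cases "a = 0")
  case True
  with assms show ?thesis by simp
next
  case False
  with assms have pos: "0 < a" "0 < b" by (auto simp: less_le)
  \<comment> \<open>Halving the logarithm before using ln u \<le> u - 1 produces the mixed term sqrt
    a * sqrt b of the square.\<close>
  have "ln (b / a) = 2 * ln (sqrt (b / a))"
    using pos by (simp add: ln_sqrt)
  moreover have "ln (sqrt (b / a)) \<le> sqrt (b / a) - 1"
    using pos by (intro ln_le_minus_one) simp
  ultimately have "2 - 2 * sqrt (b / a) \<le> ln (a / b)"
    using pos by (simp add: ln_div)
  then have "a * (2 - 2 * sqrt (b / a)) \<le> a * ln (a / b)"
    using pos by (intro mult_left_mono) auto
  moreover have "a * sqrt (b / a) = sqrt a * sqrt b"
    using pos by (simp add: real_sqrt_divide field_simps)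
  ultimately show ?thesis
    using pos by (simp add: power2_diff algebra_simps)
qed

lemma hellinger_nonneg: "0 \<le> hellinger \<gamma> \<alpha>"
  by (simp add: hellinger_def sum_nonneg)

lemma hellinger_commute: "hellinger \<gamma> \<alpha> = hellinger \<alpha> \<gamma>"
  by (simp add: hellinger_def power2_commute)

lemma sqrt_diff_sq_le_hellinger: "(sqrt (\<gamma> $ i $ j) - sqrt (\<alpha> $ i $ j))\<^sup>2 \<le> hellinger \<gamma> \<alpha>"
proof -
  have "(sqrt (\<gamma> $ i $ j) - sqrt (\<alpha> $ i $ j))\<^sup>2
      \<le> (\<Sum>j\<in>UNIV. (sqrt (\<gamma> $ i $ j) - sqrt (\<alpha> $ i $ j))\<^sup>2)"
    by (rule member_le_sum) auto
  also have "\<dots> \<le> hellinger \<gamma> \<alpha>"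
    unfolding hellinger_def by (rule member_le_sum) (auto intro: sum_nonneg)
  finally show ?thesis .
qed

lemma hellinger_le_0_imp_eq:
  assumes "hellinger \<gamma> \<alpha> \<le> 0"
  shows "\<gamma> = \<alpha>"
proof -
  have "(sqrt (\<gamma> $ i $ j) - sqrt (\<alpha> $ i $ j))\<^sup>2 \<le> 0" for i j
    using sqrt_diff_sq_le_hellinger assms by (rule order_trans)
  then show ?thesis
    by (simp add: vec_eq_iff)
qed

lemma tendsto_hellinger:
  assumes "(x \<longlongrightarrow> p) F"
  shows "((\<lambda>n. hellinger \<gamma> (x n)) \<longlongrightarrow> hellinger \<gamma> p) F"
  unfolding hellinger_def by (intro tendsto_intros assms)

text \<open>Entrywise the square roots of \<open>u n\<close> and \<open>v n\<close> approach each
  other; squaring recovers \<open>u n\<close> because its entries are nonnegative.\<close>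

lemma tendsto_if_hellinger_tendsto_0:
  assumes "\<And>n. is_measure2 (u n)" "\<And>n. is_measure2 (v n)"
    and hell: "(\<lambda>n. hellinger (u n) (v n)) \<longlonglongrightarrow> 0" and lim: "v \<longlonglongrightarrow> p"
  shows "u \<longlonglongrightarrow> p"
proof (intro vec_tendstoI)
  fix i j
  have v: "(\<lambda>n. v n $ i $ j) \<longlonglongrightarrow> p $ i $ j"
    by (intro tendsto_vec_nth lim)
  then have p: "0 \<le> p $ i $ j"
    by (rule LIMSEQ_le_const) (use assms(2) in \<open>auto simp: is_measure2_def\<close>)
  have "(\<lambda>n. (sqrt (u n $ i $ j) - sqrt (v n $ i $ j))\<^sup>2) \<longlonglongrightarrow> 0"
    by (rule real_tendsto_sandwich[OF _ _ tendsto_const hell]) (auto simp: sqrt_diff_sq_le_hellinger)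
  then have "(\<lambda>n. sqrt (u n $ i $ j) - sqrt (v n $ i $ j)) \<longlonglongrightarrow> 0"
    by simp
  from tendsto_add[OF this tendsto_real_sqrt[OF v]]
  have "(\<lambda>n. sqrt (u n $ i $ j)) \<longlonglongrightarrow> sqrt (p $ i $ j)"
    by simp
  from tendsto_power[OF this, of 2] show "(\<lambda>n. u n $ i $ j) \<longlonglongrightarrow> p $ i $ j"
    using p assms(1) by (simp add: is_measure2D)
qed

text \<open>A substitute for Pinsker's inequality.\<close>

lemma hellinger_le_rel_ent:
  assumes "is_measure2 \<gamma>" "is_measure2 \<alpha>" "abs_cont \<gamma> \<alpha>"
    and "(\<Sum>i\<in>UNIV. \<Sum>j\<in>UNIV. \<gamma> $ i $ j) = (\<Sum>i\<in>UNIV. \<Sum>j\<in>UNIV. \<alpha> $ i $ j)"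
  shows "hellinger \<gamma> \<alpha> \<le> rel_ent \<gamma> \<alpha>"
proof -
  have "hellinger \<gamma> \<alpha>
      \<le> (\<Sum>i\<in>UNIV. \<Sum>j\<in>UNIV. \<gamma> $ i $ j * ln (\<gamma> $ i $ j / \<alpha> $ i $ j) - \<gamma> $ i $ j + \<alpha> $ i $ j)"
    unfolding hellinger_def using assms(1-3)
    by (intro sum_mono sqrt_diff_sq_le) (auto simp: is_measure2_def abs_cont_def)
  also have "\<dots> = rel_ent \<gamma> \<alpha>"
    using assms(4) by (simp add: rel_ent_def sum.distrib sum_subtractf)
  finally show ?thesis .
qed

section \<open>Rescaling is the KL projection onto a marginal class\<close>

lemma abs_cont_rescale: "abs_cont (rescale s \<mu> \<gamma>) \<gamma>"
  by (simp add: abs_cont_def rescale_def)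

text \<open>The marginal carries the same factor, which cancels. This is what makes the excess mass
  of the odd iterates harmless.\<close>

lemma rescale_scaleR: "0 \<noteq> c \<Longrightarrow> rescale s \<mu> (c *\<^sub>R \<gamma>) = rescale s \<mu> \<gamma>"
  by (simp add: rescale_def marginal_scaleR vec_eq_iff)

lemma rescale_scaleR_left: "rescale s (c *\<^sub>R \<mu>) \<gamma> = c *\<^sub>R rescale s \<mu> \<gamma>"
  by (simp add: rescale_def vec_eq_iff)

lemma is_measure_if_marginal_class: "\<beta> \<in> marginal_class s \<mu> \<Longrightarrow> is_measure \<mu>"
  by (auto simp: marginal_class_def is_measure_def marginal_nonneg)

text \<open>The existence of a feasible \<open>\<beta>\<close> makes the zero denominators in
  \<open>rescale\<close> harmless: the prescribed marginal is zero there as well.\<close>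

lemma marginal_eq_0_imp:
  assumes "\<beta> \<in> marginal_class s \<mu>" "abs_cont \<beta> \<gamma>" "is_measure2 \<gamma>" "marginal s \<gamma> $ k = 0"
  shows "\<mu> $ k = 0"
proof -
  have "marginal s \<beta> $ k = 0"
    using assms by (auto simp: marginal_class_def marginal_eq_0_iff abs_cont_def)
  then show ?thesis
    using assms(1) by (simp add: marginal_class_def)
qed

lemma rescale_in_marginal_class:
  assumes "\<beta> \<in> marginal_class s \<mu>" "abs_cont \<beta> \<gamma>" "is_measure2 \<gamma>"
  shows "rescale s \<mu> \<gamma> \<in> marginal_class s \<mu>"
proof -
  have "is_measure2 (rescale s \<mu> \<gamma>)"
    using is_measure_if_marginal_class[OF assms(1)] assms(3)
    by (auto simp: is_measure2_def rescale_def is_measure_def marginal_nonneg)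
  moreover have "marginal s (rescale s \<mu> \<gamma>) $ k = \<mu> $ k" for k
  proof -
    have "marginal s (rescale s \<mu> \<gamma>) $ k
        = (\<Sum>i\<in>UNIV. \<Sum>j\<in>UNIV. (if s i j = k then \<gamma> $ i $ j else 0) * (\<mu> $ k / marginal s \<gamma> $ k))"
      unfolding marginal_def[of s "rescale s \<mu> \<gamma>"] by (auto simp: rescale_def intro!: sum.cong)
    also have "\<dots> = marginal s \<gamma> $ k * (\<mu> $ k / marginal s \<gamma> $ k)"
      unfolding sum_distrib_right[symmetric] by (simp add: marginal_def)
    also have "\<dots> = \<mu> $ k"
      using marginal_eq_0_imp[OF assms, of k] by auto
    finally show ?thesis .
  qed
  ultimately show ?thesis
    by (simp add: marginal_class_def vec_eq_iff)
qed

text \<open>Rescaling deletes a positive entry of \<open>\<gamma>\<close> only where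
  \<open>\<mu>\<close> vanishes, and there \<open>\<beta>\<close> has no mass either. So feasibility
  survives the step.\<close>

lemma abs_cont_rescale_right:
  assumes "\<beta> \<in> marginal_class s \<mu>" "abs_cont \<beta> \<gamma>" "is_measure2 \<gamma>"
  shows "abs_cont \<beta> (rescale s \<mu> \<gamma>)"
  unfolding abs_cont_def
proof (intro allI impI)
  fix i j
  assume "rescale s \<mu> \<gamma> $ i $ j = 0"
  then have "\<gamma> $ i $ j = 0 \<or> \<mu> $ s i j = 0 \<or> marginal s \<gamma> $ s i j = 0"
    by (auto simp: rescale_def)
  then have "\<gamma> $ i $ j = 0 \<or> \<mu> $ s i j = 0"
    using marginal_eq_0_imp[OF assms] by blast
  moreover have "\<mu> $ s i j = 0 \<longrightarrow> \<beta> $ i $ j = 0"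
    using assms(1) by (auto simp: marginal_class_def marginal_eq_0_iff)
  ultimately show "\<beta> $ i $ j = 0"
    using assms(2) by (auto simp: abs_cont_def)
qed

text \<open>The rescaling factor depends on the entry only through \<open>s i j\<close>, so the
  integral of its logarithm against \<open>\<beta>\<close> sees only the marginal of
  \<open>\<beta>\<close>.\<close>

lemma rel_ent_rescale_split:
  assumes "is_measure2 \<beta>" "is_measure2 \<gamma>" "abs_cont \<beta> (rescale s \<mu> \<gamma>)" "is_measure2 (rescale s \<mu> \<gamma>)"
  shows "rel_ent \<beta> \<gamma> = rel_ent \<beta> (rescale s \<mu> \<gamma>)
    + (\<Sum>k\<in>UNIV. marginal s \<beta> $ k * ln (\<mu> $ k / marginal s \<gamma> $ k))"
proof -
  let ?w = "\<lambda>k. \<mu> $ k / marginal s \<gamma> $ k"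
  have "\<beta> $ i $ j * ln (\<beta> $ i $ j / \<gamma> $ i $ j)
      = \<beta> $ i $ j * ln (\<beta> $ i $ j / rescale s \<mu> \<gamma> $ i $ j) + \<beta> $ i $ j * ln (?w (s i j))" for i j
  proof (cases "\<beta> $ i $ j = 0")
    case False
    let ?g = "\<gamma> $ i $ j" and ?b = "\<beta> $ i $ j"
    have b: "0 < ?b"
      using False is_measure2D[OF assms(1), of i j] by simp
    have "rescale s \<mu> \<gamma> $ i $ j \<noteq> 0"
      using False assms(3) by (auto simp: abs_cont_def)
    moreover have r: "rescale s \<mu> \<gamma> $ i $ j = ?g * ?w (s i j)"
      by (simp add: rescale_def)
    \<comment> \<open>The product is nonzero and nonnegative; as \<open>?g\<close> is nonnegative,
      both factors are positive, which the product rule for \<open>ln\<close> needs.\<close>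
    ultimately have "0 < ?g * ?w (s i j)"
      using is_measure2D[OF assms(4), of i j] by (simp only: less_le) (metis)
    with is_measure2D[OF assms(2), of i j] have "0 < ?g" "0 < ?w (s i j)"
      by (auto simp only: zero_less_mult_iff)
    moreover have "ln (b / g) = ln (b / (g * c)) + ln c" if "0 < b" "0 < g" "0 < c" for b g c :: real
      using that by (simp add: ln_div ln_mult_pos)
    ultimately have "ln (?b / ?g) = ln (?b / (?g * ?w (s i j))) + ln (?w (s i j))"
      using b by blast
    then show ?thesis
      unfolding r by (simp only: distrib_left)
  qed simp
  then have "rel_ent \<beta> \<gamma> = rel_ent \<beta> (rescale s \<mu> \<gamma>)
      + (\<Sum>i\<in>UNIV. \<Sum>j\<in>UNIV. \<beta> $ i $ j * ln (?w (s i j)))"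
    by (simp only: rel_ent_def sum.distrib)
  then show ?thesis
    by (simp only: sum_marginal[of \<beta> "\<lambda>k. ln (?w k)" s])
qed

text \<open>The splitting is applied to \<open>\<beta>\<close> and to the rescaled matrix itself.
  Both have marginal \<open>\<mu>\<close>, so the correction terms agree, and for the rescaled
  matrix the correction is its whole entropy.\<close>

lemma rel_ent_pythagoras:
  assumes "\<beta> \<in> marginal_class s \<mu>" "abs_cont \<beta> \<gamma>" "is_measure2 \<gamma>"
  shows "rel_ent \<beta> \<gamma> = rel_ent \<beta> (rescale s \<mu> \<gamma>) + rel_ent (rescale s \<mu> \<gamma>) \<gamma>"
proof -
  have r: "rescale s \<mu> \<gamma> \<in> marginal_class s \<mu>"
    by (rule rescale_in_marginal_class[OF assms])
  have "rel_ent (rescale s \<mu> \<gamma>) \<gamma> = rel_ent (rescale s \<mu> \<gamma>) (rescale s \<mu> \<gamma>)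
      + (\<Sum>k\<in>UNIV. marginal s (rescale s \<mu> \<gamma>) $ k * ln (\<mu> $ k / marginal s \<gamma> $ k))"
    using r assms(3) by (intro rel_ent_rescale_split) (auto simp: marginal_class_def abs_cont_def)
  moreover have "rel_ent (rescale s \<mu> \<gamma>) (rescale s \<mu> \<gamma>) = 0"
    unfolding rel_ent_def by (intro sum.neutral ballI) auto
  moreover have "rel_ent \<beta> \<gamma> = rel_ent \<beta> (rescale s \<mu> \<gamma>)
      + (\<Sum>k\<in>UNIV. marginal s \<beta> $ k * ln (\<mu> $ k / marginal s \<gamma> $ k))"
    using r assms abs_cont_rescale_right[OF assms]
    by (intro rel_ent_rescale_split) (auto simp: marginal_class_def)
  ultimately show ?thesis
    using r assms(1) by (simp add: marginal_class_def)
qed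

text \<open>The Hellinger term in \<open>ge\<close> is a quantitative gap: it gives minimality and,
  vanishing only for equal matrices, also uniqueness. Other competitors have infinite KL.\<close>

lemma KL_proj_eqI:
  assumes "\<gamma> \<in> C" "abs_cont \<gamma> \<alpha>"
    and ge: "\<And>\<beta>. \<beta> \<in> C \<Longrightarrow> abs_cont \<beta> \<alpha> \<Longrightarrow> rel_ent \<gamma> \<alpha> + hellinger \<beta> \<gamma> \<le> rel_ent \<beta> \<alpha>"
  shows "unique_KL_minimizer C \<alpha>" and "KL_proj C \<alpha> = \<gamma>"
proof -
  have min: "is_arg_min (\<lambda>\<gamma>. KL \<gamma> \<alpha>) (\<lambda>\<gamma>. \<gamma> \<in> C) \<gamma>"
    unfolding is_arg_min_def
  proof (intro conjI notI)
    assume "\<exists>\<beta>. \<beta> \<in> C \<and> KL \<beta> \<alpha> < KL \<gamma> \<alpha>"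
    then obtain \<beta> where "\<beta> \<in> C" "KL \<beta> \<alpha> < KL \<gamma> \<alpha>" by blast
    with ge[of \<beta>] hellinger_nonneg[of \<beta> \<gamma>] assms(2) show False
      by (auto simp: KL_eq_rel_ent split: if_splits)
  qed fact
  have uniq: "\<beta> = \<gamma>" if "is_arg_min (\<lambda>\<gamma>. KL \<gamma> \<alpha>) (\<lambda>\<gamma>. \<gamma> \<in> C) \<beta>" for \<beta>
  proof -
    have "\<beta> \<in> C" "\<not> KL \<gamma> \<alpha> < KL \<beta> \<alpha>"
      using that assms(1) by (auto simp: is_arg_min_def)
    then have "abs_cont \<beta> \<alpha>" "rel_ent \<beta> \<alpha> \<le> rel_ent \<gamma> \<alpha>"
      using assms(2) by (auto simp: KL_eq_rel_ent split: if_splits)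
    with ge[OF \<open>\<beta> \<in> C\<close>] have "hellinger \<beta> \<gamma> \<le> 0" by auto
    then show ?thesis by (rule hellinger_le_0_imp_eq)
  qed
  show "unique_KL_minimizer C \<alpha>"
    unfolding unique_KL_minimizer_def using min uniq by blast
  show "KL_proj C \<alpha> = \<gamma>"
    unfolding KL_proj_def arg_min_def using min uniq by (rule some_equality)
qed

text \<open>The gap is the Pythagorean remainder, bounded below by the Hellinger distance because
  all members of the class have the same total mass.\<close>

lemma KL_proj_marginal_class:
  assumes "\<beta> \<in> marginal_class s \<mu>" "abs_cont \<beta> \<gamma>" "is_measure2 \<gamma>"
  shows "unique_KL_minimizer (marginal_class s \<mu>) \<gamma>"
    and "KL_proj (marginal_class s \<mu>) \<gamma> = rescale s \<mu> \<gamma>"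
proof -
  have r: "rescale s \<mu> \<gamma> \<in> marginal_class s \<mu>"
    by (rule rescale_in_marginal_class[OF assms])
  have ge: "rel_ent (rescale s \<mu> \<gamma>) \<gamma> + hellinger \<pi> (rescale s \<mu> \<gamma>) \<le> rel_ent \<pi> \<gamma>"
    if "\<pi> \<in> marginal_class s \<mu>" "abs_cont \<pi> \<gamma>" for \<pi>
  proof -
    have "hellinger \<pi> (rescale s \<mu> \<gamma>) \<le> rel_ent \<pi> (rescale s \<mu> \<gamma>)"
      using that r abs_cont_rescale_right[OF that assms(3)]
        sum_marginal_class[OF that(1)] sum_marginal_class[OF r]
      by (intro hellinger_le_rel_ent) (auto simp: marginal_class_def)
    then show ?thesis
      using rel_ent_pythagoras[OF that assms(3)] by simp
  qed
  show "unique_KL_minimizer (marginal_class s \<mu>) \<gamma>"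
    "KL_proj (marginal_class s \<mu>) \<gamma> = rescale s \<mu> \<gamma>"
    using KL_proj_eqI[OF r abs_cont_rescale ge] by blast+
qed

section \<open>Limits and boundedness\<close>

lemma tendsto_rel_ent_self:
  assumes "x \<longlonglongrightarrow> p"
  shows "(\<lambda>n. rel_ent p (x n)) \<longlonglongrightarrow> 0"
proof -
  have "(\<lambda>n. p $ i $ j * ln (p $ i $ j / x n $ i $ j)) \<longlonglongrightarrow> 0" for i j
  proof (cases "p $ i $ j = 0")
    \<comment> \<open>Only entries in the support of \<open>p\<close> matter, and there the
      logarithm is continuous at the limit; elsewhere the term is 0 whatever \<open>x n\<close>
      is.\<close>
    case False
    have "(\<lambda>n. p $ i $ j * ln (p $ i $ j / x n $ i $ j))
        \<longlonglongrightarrow> p $ i $ j * ln (p $ i $ j / p $ i $ j)"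
      using False by (intro tendsto_intros assms) auto
    with False show ?thesis by simp
  qed simp
  then have "(\<lambda>n. rel_ent p (x n)) \<longlonglongrightarrow> (\<Sum>i\<in>(UNIV :: 'a set). \<Sum>j\<in>(UNIV :: 'a set). 0)"
    unfolding rel_ent_def by (intro tendsto_sum)
  then show ?thesis by simp
qed

lemma bounded_marginal_class: "bounded (marginal_class s \<mu>)"
proof (rule boundedI)
  fix \<gamma> assume \<gamma>: "\<gamma> \<in> marginal_class s \<mu>"
  have "norm \<gamma> \<le> (\<Sum>i\<in>UNIV. norm (\<gamma> $ i))"
    unfolding norm_vec_def by (rule L2_set_le_sum) simp
  also have "\<dots> \<le> (\<Sum>i\<in>UNIV. \<Sum>j\<in>UNIV. norm (\<gamma> $ i $ j))"
    unfolding norm_vec_def[of "_ $ _"] by (intro sum_mono L2_set_le_sum) simp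
  also have "\<dots> = mass \<mu>"
    using \<gamma> sum_marginal_class[OF \<gamma>] by (simp add: marginal_class_def is_measure2_def)
  finally show "norm \<gamma> \<le> mass \<mu>" .
qed

section \<open>Alternating rescaling for two marginals of equal mass\<close>

locale sinkhorn =
  fixes s t :: "'d::finite \<Rightarrow> 'd \<Rightarrow> 'd" and \<mu> \<nu> :: "real ^ 'd" and \<alpha> \<pi>\<^sub>0 :: "'d mat"
    and x :: "nat \<Rightarrow> 'd mat"
  assumes mass_eq: "mass \<mu> = mass \<nu>"
    and measure_\<alpha>: "is_measure2 \<alpha>"
    and feasible: "\<pi>\<^sub>0 \<in> marginal_class s \<mu>" "\<pi>\<^sub>0 \<in> marginal_class t \<nu>" "abs_cont \<pi>\<^sub>0 \<alpha>"
    and x_0: "x 0 = \<alpha>"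
    and x_Suc: "\<And>k. x (Suc k) = rescale t \<nu> (rescale s \<mu> (x k))"
begin

definition y :: "nat \<Rightarrow> 'd mat" where
  "y k = rescale s \<mu> (x k)"

text \<open>Exactly the couplings of finite KL divergence from \<alpha>; \<open>feasible\<close>
  provides one.\<close>

definition plans :: "'d mat set" where
  "plans = {\<pi> \<in> marginal_class s \<mu> \<inter> marginal_class t \<nu>. abs_cont \<pi> \<alpha>}"

lemma x_Suc_y: "x (Suc k) = rescale t \<nu> (y k)"
  by (simp add: x_Suc y_def)

text \<open>The first two invariants make each next rescaling well defined with a plan as feasible
  witness; the third later shows that cluster points are absolutely continuous with respect to
  \<alpha>.\<close>

lemma measure_abs_cont_x: "is_measure2 (x k) \<and> (\<forall>\<pi>\<in>plans. abs_cont \<pi> (x k)) \<and> abs_cont (x k) \<alpha>"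
proof (induction k)
  case 0
  show ?case
    using measure_\<alpha> by (simp add: x_0 plans_def) (simp add: abs_cont_def)
next
  case (Suc k)
  have \<pi>\<^sub>0: "\<pi>\<^sub>0 \<in> plans"
    using feasible by (simp add: plans_def)
  have y: "y k \<in> marginal_class s \<mu>"
    unfolding y_def using Suc \<pi>\<^sub>0 by (intro rescale_in_marginal_class[of \<pi>\<^sub>0]) (auto simp: plans_def)
  then have my: "is_measure2 (y k)"
    by (simp add: marginal_class_def)
  have ay: "abs_cont \<pi> (y k)" if "\<pi> \<in> plans" for \<pi>
    unfolding y_def using Suc that by (intro abs_cont_rescale_right) (auto simp: plans_def)
  have "x (Suc k) \<in> marginal_class t \<nu>"
    unfolding x_Suc_y using \<pi>\<^sub>0 my ay
    by (intro rescale_in_marginal_class[of \<pi>\<^sub>0]) (auto simp: plans_def)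
  then have "is_measure2 (x (Suc k))"
    by (simp add: marginal_class_def)
  moreover have "abs_cont \<pi> (x (Suc k))" if "\<pi> \<in> plans" for \<pi>
    unfolding x_Suc_y using my ay that by (intro abs_cont_rescale_right) (auto simp: plans_def)
  moreover have "abs_cont (x (Suc k)) \<alpha>"
    unfolding x_Suc using Suc
    by (intro abs_cont_trans[OF abs_cont_rescale abs_cont_trans[OF abs_cont_rescale]]) auto
  ultimately show ?case by simp
qed

lemmas measure_x = conjunct1[OF measure_abs_cont_x]

lemma abs_cont_x: "\<pi> \<in> plans \<Longrightarrow> abs_cont \<pi> (x k)"
  using measure_abs_cont_x by blast

lemma feasible_plans: "\<pi>\<^sub>0 \<in> plans"
  using feasible by (simp add: plans_def)

lemma y_marginal: "y k \<in> marginal_class s \<mu>"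
  unfolding y_def using measure_x feasible abs_cont_x[OF feasible_plans]
  by (intro rescale_in_marginal_class[of \<pi>\<^sub>0])

lemma measure_y: "is_measure2 (y k)"
  using y_marginal[of k] by (simp add: marginal_class_def)

lemma abs_cont_y: "\<pi> \<in> plans \<Longrightarrow> abs_cont \<pi> (y k)"
  unfolding y_def using abs_cont_x measure_x by (intro abs_cont_rescale_right) (auto simp: plans_def)

lemma x_marginal: "x (Suc k) \<in> marginal_class t \<nu>"
  unfolding x_Suc_y using measure_y feasible abs_cont_y[OF feasible_plans]
  by (intro rescale_in_marginal_class[of \<pi>\<^sub>0])

text \<open>Pythagoras for both half steps. The decrement does not involve
  \<open>\<pi>\<close>.\<close>

lemma rel_ent_step:
  assumes "\<pi> \<in> plans"
  shows "rel_ent \<pi> (x k) = rel_ent \<pi> (x (Suc k)) + (rel_ent (y k) (x k) + rel_ent (x (Suc k)) (y k))"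
proof -
  have "rel_ent \<pi> (x k) = rel_ent \<pi> (y k) + rel_ent (y k) (x k)"
    unfolding y_def using assms abs_cont_x measure_x
    by (intro rel_ent_pythagoras) (auto simp: plans_def)
  moreover have "rel_ent \<pi> (y k) = rel_ent \<pi> (x (Suc k)) + rel_ent (x (Suc k)) (y k)"
    unfolding x_Suc_y using assms abs_cont_y measure_y
    by (intro rel_ent_pythagoras) (auto simp: plans_def)
  ultimately show ?thesis by simp
qed

text \<open>Equal decrements cancel at every step, so comparing two plans relative to \<alpha> is
  the same as comparing them relative to any iterate.\<close>

lemma rel_ent_diff_eq:
  assumes "\<pi> \<in> plans" "\<rho> \<in> plans"
  shows "rel_ent \<pi> \<alpha> - rel_ent \<rho> \<alpha> = rel_ent \<pi> (x k) - rel_ent \<rho> (x k)"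
proof (induction k)
  case (Suc k)
  then show ?case
    using rel_ent_step[OF assms(1), of k] rel_ent_step[OF assms(2), of k] by simp
qed (simp add: x_0)

text \<open>The index starts at \<open>Suc k\<close> because \<open>x 0\<close> is \<alpha>, whose
  mass is arbitrary, while the Hellinger bound needs equal masses.\<close>

lemma hellinger_le_rel_ent_x: "\<pi> \<in> plans \<Longrightarrow> hellinger \<pi> (x (Suc k)) \<le> rel_ent \<pi> (x (Suc k))"
  using measure_x abs_cont_x sum_marginal_class[OF x_marginal] sum_marginal_class[of \<pi> t \<nu>]
  by (intro hellinger_le_rel_ent) (auto simp: plans_def marginal_class_def)

lemma hellinger_le_rel_ent_yx: "hellinger (y (Suc k)) (x (Suc k)) \<le> rel_ent (y (Suc k)) (x (Suc k))"
  using measure_x measure_y sum_marginal_class[OF x_marginal] sum_marginal_class[OF y_marginal]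
    mass_eq abs_cont_rescale[of s \<mu> "x (Suc k)"]
  by (intro hellinger_le_rel_ent) (auto simp: y_def)

lemma hellinger_le_rel_ent_xy: "hellinger (x (Suc k)) (y k) \<le> rel_ent (x (Suc k)) (y k)"
  using measure_x measure_y sum_marginal_class[OF x_marginal] sum_marginal_class[OF y_marginal]
    mass_eq abs_cont_rescale[of t \<nu> "y k"]
  by (intro hellinger_le_rel_ent) (auto simp flip: x_Suc_y)

lemma hellinger_step:
  assumes "\<pi> \<in> plans"
  shows "hellinger (y (Suc k)) (x (Suc k)) \<le> rel_ent \<pi> (x (Suc k)) - rel_ent \<pi> (x (Suc (Suc k)))"
  using rel_ent_step[OF assms, of "Suc k"] hellinger_le_rel_ent_yx[of k]
    hellinger_le_rel_ent_xy[of "Suc k"] hellinger_nonneg[of "x (Suc (Suc k))" "y (Suc k)"] by linarith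

lemma rel_ent_decreasing: "\<pi> \<in> plans \<Longrightarrow> decseq (\<lambda>k. rel_ent \<pi> (x (Suc k)))"
  unfolding decseq_Suc_iff using hellinger_step hellinger_nonneg by (smt (verit))

text \<open>The entropy relative to the iterates decreases and is bounded below, so its decrements
  tend to 0; they dominate these distances.\<close>

lemma hellinger_yx_tendsto_0: "(\<lambda>k. hellinger (y (Suc k)) (x (Suc k))) \<longlonglongrightarrow> 0"
proof -
  let ?f = "\<lambda>k. rel_ent \<pi>\<^sub>0 (x (Suc k))"
  have "\<forall>k. 0 \<le> ?f k"
    using hellinger_le_rel_ent_x[OF feasible_plans] hellinger_nonneg order_trans by blast
  then obtain L where L: "?f \<longlonglongrightarrow> L"
    using decseq_convergent[OF rel_ent_decreasing[OF feasible_plans], of 0] by blast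
  have lim: "(\<lambda>k. ?f k - ?f (Suc k)) \<longlonglongrightarrow> 0"
    using tendsto_diff[OF L LIMSEQ_Suc[OF L]] by simp
  show ?thesis
    by (rule real_tendsto_sandwich[OF _ _ tendsto_const lim])
       (simp_all add: hellinger_step[OF feasible_plans] hellinger_nonneg)
qed

lemma convergence:
  obtains p where "p \<in> plans" "x \<longlonglongrightarrow> p" "y \<longlonglongrightarrow> p"
    "\<And>\<pi>. \<pi> \<in> plans \<Longrightarrow> rel_ent p \<alpha> + hellinger \<pi> p \<le> rel_ent \<pi> \<alpha>"
proof -
  have "bounded (range (\<lambda>k. x (Suc k)))"
    by (rule bounded_subset[OF bounded_marginal_class[of t \<nu>]]) (use x_marginal in auto)
  then obtain p r where r: "strict_mono (r :: nat \<Rightarrow> nat)"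
    and sub: "((\<lambda>k. x (Suc k)) \<circ> r) \<longlonglongrightarrow> p"
    using bounded_imp_convergent_subsequence by blast
  have xr: "(\<lambda>n. x (Suc (r n))) \<longlonglongrightarrow> p"
    using sub by (simp add: o_def)
  \<comment> \<open>The same subsequence of \<open>y\<close> has the limit \<open>p\<close>, so
    \<open>p\<close> inherits the first marginal from \<open>y\<close> and the second from
    \<open>x\<close>.\<close>
  have yr: "(\<lambda>n. y (Suc (r n))) \<longlonglongrightarrow> p"
    using LIMSEQ_subseq_LIMSEQ[OF hellinger_yx_tendsto_0 r] xr measure_x measure_y
    by (intro tendsto_if_hellinger_tendsto_0[of "\<lambda>n. y (Suc (r n))" "\<lambda>n. x (Suc (r n))"])
       (auto simp: o_def)
  have "p \<in> marginal_class s \<mu>" "p \<in> marginal_class t \<nu>"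
    using marginal_class_closed[OF _ yr] marginal_class_closed[OF _ xr] x_marginal y_marginal
    by blast+
  moreover have "abs_cont p \<alpha>"
    unfolding abs_cont_def
  proof (intro allI impI)
    fix i j
    assume "\<alpha> $ i $ j = 0"
    then have "x (Suc (r n)) $ i $ j = 0" for n
      using measure_abs_cont_x[of "Suc (r n)"] by (simp add: abs_cont_def)
    then have "(\<lambda>n. 0) \<longlonglongrightarrow> p $ i $ j"
      using tendsto_vec_nth[OF tendsto_vec_nth[OF xr], of i j] by simp
    then show "p $ i $ j = 0"
      by (simp add: LIMSEQ_const_iff)
  qed
  ultimately have p: "p \<in> plans"
    by (simp add: plans_def)
  then have mp: "is_measure2 p"
    by (simp add: plans_def marginal_class_def)
  have ent: "(\<lambda>k. rel_ent p (x (Suc k))) \<longlonglongrightarrow> 0"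
  proof -
    have "\<forall>k. 0 \<le> rel_ent p (x (Suc k))"
      using hellinger_le_rel_ent_x[OF p] hellinger_nonneg order_trans by blast
    then obtain L where L: "(\<lambda>k. rel_ent p (x (Suc k))) \<longlonglongrightarrow> L"
      using decseq_convergent[OF rel_ent_decreasing[OF p], of 0] by blast
    \<comment> \<open>Monotonicity gives a limit for the whole sequence, and the subsequence
      converging to \<open>p\<close> identifies it as 0.\<close>
    have "L = 0"
      using LIMSEQ_unique[OF LIMSEQ_subseq_LIMSEQ[OF L r, unfolded o_def] tendsto_rel_ent_self[OF xr]] .
    with L show ?thesis by simp
  qed
  have "(\<lambda>k. hellinger p (x (Suc k))) \<longlonglongrightarrow> 0"
    by (rule real_tendsto_sandwich[OF _ _ tendsto_const ent])
       (simp_all add: hellinger_nonneg hellinger_le_rel_ent_x[OF p])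
  then have x: "(\<lambda>k. x (Suc k)) \<longlonglongrightarrow> p"
    using measure_x mp
    by (intro tendsto_if_hellinger_tendsto_0[of "\<lambda>k. x (Suc k)" "\<lambda>_. p"])
       (auto simp: hellinger_commute)
  have y: "(\<lambda>k. y (Suc k)) \<longlonglongrightarrow> p"
    by (rule tendsto_if_hellinger_tendsto_0[OF measure_y measure_x hellinger_yx_tendsto_0 x])
  \<comment> \<open>The entropy of \<open>\<pi>\<close> relative to the iterates is replaced by its
    Hellinger lower bound, which is continuous; the entropy of \<open>p\<close> tends to 0.\<close>
  have "rel_ent p \<alpha> + hellinger \<pi> p \<le> rel_ent \<pi> \<alpha>" if "\<pi> \<in> plans" for \<pi>
  proof -
    have "(\<lambda>k. hellinger \<pi> (x (Suc k)) - rel_ent p (x (Suc k))) \<longlonglongrightarrow> hellinger \<pi> p - 0"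
      by (intro tendsto_diff tendsto_hellinger x ent)
    moreover have "hellinger \<pi> (x (Suc k)) - rel_ent p (x (Suc k)) \<le> rel_ent \<pi> \<alpha> - rel_ent p \<alpha>" for k
      using rel_ent_diff_eq[OF that p, of "Suc k"] hellinger_le_rel_ent_x[OF that, of k] by simp
    ultimately have "hellinger \<pi> p - 0 \<le> rel_ent \<pi> \<alpha> - rel_ent p \<alpha>"
      by (intro LIMSEQ_le_const2) auto
    then show ?thesis by simp
  qed
  with p x y show thesis
    by (intro that[of p]) (auto dest: LIMSEQ_imp_Suc)
qed

end

section \<open>Transfer to the scheme with unequal masses\<close>

theorem theorem5p5:
  fixes \<nu>\<^sub>0 \<nu>\<^sub>1 \<nu>\<^sub>0' :: "real ^ 'd::finite"
    and \<alpha> :: "real ^ 'd ^ 'd"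
    and \<gamma> :: "nat \<Rightarrow> real ^ 'd ^ 'd"
    and m\<^sub>0 :: real
  assumes "is_measure \<nu>\<^sub>1" and "mass \<nu>\<^sub>1 = 1"
    and "is_measure \<nu>\<^sub>0" and "m\<^sub>0 = mass \<nu>\<^sub>0" and "m\<^sub>0 > 1"
    and "\<nu>\<^sub>0' = (1 / m\<^sub>0) *\<^sub>R \<nu>\<^sub>0"
    and "is_measure2 \<alpha>"
    and proj_exists: "\<exists>\<pi>\<in>transport_plans \<nu>\<^sub>0' \<nu>\<^sub>1. KL \<pi> \<alpha> < \<infinity>"
    and "\<gamma> 0 = \<alpha>"
    and "\<And>k. \<gamma> (2 * k + 1) = KL_proj (C1 \<nu>\<^sub>0) (\<gamma> (2 * k))"
    and "\<And>k. \<gamma> (2 * k + 2) = KL_proj (C2 \<nu>\<^sub>1) (\<gamma> (2 * k + 1))"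
  shows "unique_KL_minimizer (transport_plans \<nu>\<^sub>0' \<nu>\<^sub>1) \<alpha>
    \<and> (\<forall>k. unique_KL_minimizer (C1 \<nu>\<^sub>0) (\<gamma> (2 * k)))
    \<and> (\<forall>k. unique_KL_minimizer (C2 \<nu>\<^sub>1) (\<gamma> (2 * k + 1)))
    \<and> (\<lambda>k. \<gamma> (2 * k)) \<longlonglongrightarrow> KL_proj (transport_plans \<nu>\<^sub>0' \<nu>\<^sub>1) \<alpha>
    \<and> KL_proj (transport_plans \<nu>\<^sub>0' \<nu>\<^sub>1) \<alpha> \<in> C2 \<nu>\<^sub>1
    \<and> (\<lambda>k. \<gamma> (2 * k + 1)) \<longlonglongrightarrow> sh_inv \<nu>\<^sub>0 (KL_proj (transport_plans \<nu>\<^sub>0' \<nu>\<^sub>1) \<alpha>)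
    \<and> sh_inv \<nu>\<^sub>0 (KL_proj (transport_plans \<nu>\<^sub>0' \<nu>\<^sub>1) \<alpha>) \<in> C1 \<nu>\<^sub>0
    \<and> sh_inv \<nu>\<^sub>0 (KL_proj (transport_plans \<nu>\<^sub>0' \<nu>\<^sub>1) \<alpha>) \<noteq> KL_proj (transport_plans \<nu>\<^sub>0' \<nu>\<^sub>1) \<alpha>"
proof -
  let ?s = "\<lambda>i j :: 'd. i" and ?t = "\<lambda>i j :: 'd. j"
  have m0: "0 < m\<^sub>0" "m\<^sub>0 \<noteq> 0"
    using assms(5) by auto
  have \<nu>\<^sub>0: "\<nu>\<^sub>0 = m\<^sub>0 *\<^sub>R \<nu>\<^sub>0'"
    using m0 assms(6) by simp
  have mass': "mass \<nu>\<^sub>0' = 1"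
    using m0 assms(4,6) by (simp add: mass_def flip: sum_divide_distrib)
  obtain \<pi>\<^sub>0 where \<pi>\<^sub>0: "\<pi>\<^sub>0 \<in> marginal_class ?s \<nu>\<^sub>0'" "\<pi>\<^sub>0 \<in> marginal_class ?t \<nu>\<^sub>1" "abs_cont \<pi>\<^sub>0 \<alpha>"
    using proj_exists
    by (auto simp: transport_plans_def C1_eq_marginal_class C2_eq_marginal_class KL_eq_rel_ent
        split: if_splits)
  \<comment> \<open>The normalised scheme aims at \<open>\<nu>\<^sub>0'\<close>. It will turn out
    that \<open>x k\<close> is the even iterate and \<open>m\<^sub>0 *\<^sub>R y k\<close> the odd
    one.\<close>
  define x where "x = rec_nat \<alpha> (\<lambda>_ g. rescale ?t \<nu>\<^sub>1 (rescale ?s \<nu>\<^sub>0' g))"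
  interpret sinkhorn ?s ?t \<nu>\<^sub>0' \<nu>\<^sub>1 \<alpha> \<pi>\<^sub>0 x
  proof
    show "mass \<nu>\<^sub>0' = mass \<nu>\<^sub>1" "is_measure2 \<alpha>"
      using assms(2,7) mass' by simp_all
  qed (fact \<pi>\<^sub>0 | simp add: x_def)+
  \<comment> \<open>Feasible witness for the projections onto \<open>C1 \<nu>\<^sub>0\<close>; for
    \<open>C2 \<nu>\<^sub>1\<close> the plan \<open>\<pi>\<^sub>0\<close> itself serves.\<close>
  have scaled: "m\<^sub>0 *\<^sub>R \<pi>\<^sub>0 \<in> marginal_class ?s \<nu>\<^sub>0"
    using C1_scaleR[of \<pi>\<^sub>0 \<nu>\<^sub>0' m\<^sub>0] \<pi>\<^sub>0(1) m0 by (simp add: C1_eq_marginal_class \<nu>\<^sub>0)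
  have ac: "abs_cont (m\<^sub>0 *\<^sub>R \<pi>\<^sub>0) (x k)" "abs_cont \<pi>\<^sub>0 (m\<^sub>0 *\<^sub>R y k)" for k
    using abs_cont_x[OF feasible_plans, of k] abs_cont_y[OF feasible_plans, of k] m0
    by (auto simp: abs_cont_def)
  have proj1: "unique_KL_minimizer (C1 \<nu>\<^sub>0) (x k)" "KL_proj (C1 \<nu>\<^sub>0) (x k) = m\<^sub>0 *\<^sub>R y k" for k
    using KL_proj_marginal_class[OF scaled ac(1) measure_x, of k]
    unfolding C1_eq_marginal_class by (simp_all add: y_def \<nu>\<^sub>0 rescale_scaleR_left)
  \<comment> \<open>Here the factor \<open>m\<^sub>0\<close> disappears, since rescaling ignores
    scalar factors of its argument.\<close>
  have proj2: "unique_KL_minimizer (C2 \<nu>\<^sub>1) (m\<^sub>0 *\<^sub>R y k)"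
    "KL_proj (C2 \<nu>\<^sub>1) (m\<^sub>0 *\<^sub>R y k) = x (Suc k)" for k
    using KL_proj_marginal_class[OF \<pi>\<^sub>0(2) ac(2) is_measure2_scaleR[OF measure_y], of k] m0
    unfolding C2_eq_marginal_class by (simp_all add: x_Suc_y rescale_scaleR)
  have even: "\<gamma> (2 * k) = x k" for k
  proof (induction k)
    case 0
    show ?case using assms(9) by (simp add: x_0)
  next
    case (Suc k)
    then show ?case
      using assms(10,11)[of k] proj1(2)[of k] proj2(2)[of k] by simp
  qed
  have odd: "\<gamma> (2 * k + 1) = m\<^sub>0 *\<^sub>R y k" for k
    using assms(10)[of k] proj1(2)[of k] by (simp add: even)
  obtain p where p: "p \<in> plans" "x \<longlonglongrightarrow> p" "y \<longlonglongrightarrow> p"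
    "\<And>\<pi>. \<pi> \<in> plans \<Longrightarrow> rel_ent p \<alpha> + hellinger \<pi> p \<le> rel_ent \<pi> \<alpha>"
    by (rule convergence) (rule that)
  have plans: "\<pi> \<in> plans \<longleftrightarrow> \<pi> \<in> transport_plans \<nu>\<^sub>0' \<nu>\<^sub>1 \<and> abs_cont \<pi> \<alpha>" for \<pi>
    by (simp add: plans_def transport_plans_def C1_eq_marginal_class C2_eq_marginal_class)
  have proj: "unique_KL_minimizer (transport_plans \<nu>\<^sub>0' \<nu>\<^sub>1) \<alpha>"
    "KL_proj (transport_plans \<nu>\<^sub>0' \<nu>\<^sub>1) \<alpha> = p"
    using KL_proj_eqI[of p "transport_plans \<nu>\<^sub>0' \<nu>\<^sub>1" \<alpha>] p(1,4) by (auto simp: plans)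
  have pC: "p \<in> C1 \<nu>\<^sub>0'" "p \<in> C2 \<nu>\<^sub>1"
    using p(1) by (auto simp: plans transport_plans_def)
  have inv: "sh_inv \<nu>\<^sub>0 p = m\<^sub>0 *\<^sub>R p"
    using sh_inv_eq[of \<nu>\<^sub>0 p] pC(1) m0 assms(4,6) by simp
  have "m\<^sub>0 *\<^sub>R p \<in> C1 \<nu>\<^sub>0"
    using C1_scaleR[OF pC(1), of m\<^sub>0] m0 by (simp add: \<nu>\<^sub>0)
  \<comment> \<open>Its total mass is 1. Since \<open>m\<^sub>0\<close> differs from 1, the even and
    odd limits are then distinct.\<close>
  moreover have "p \<noteq> 0"
    using sum_marginal_class[of p ?s \<nu>\<^sub>0'] pC(1) mass' by (auto simp: C1_eq_marginal_class)
  then have "m\<^sub>0 *\<^sub>R p \<noteq> p"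
    using assms(5) scaleR_cancel_right[of m\<^sub>0 p 1] by simp
  moreover have "(\<lambda>k. m\<^sub>0 *\<^sub>R y k) \<longlonglongrightarrow> m\<^sub>0 *\<^sub>R p"
    by (intro tendsto_intros p(3))
  ultimately show ?thesis
    using proj proj1(1) proj2(1) pC(2) p(2) by (simp add: inv even odd[simplified])
qed

end
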